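(* Let $n\ge 2$ and let $P$ be an $n\times n$ permutation matrix. Then $P$ is the leaf matrix of exactly one CNM of size $n$ if and only if (a) for every $k$ with $2\le k\le n-1$ the $k$-th L-subset of $P$ contains exactly one entry equal to $1$, and (b) $P$ has no entry equal to $1$ on its main diagonal.
   Context: A complete non-ambiguous matrix (CNM) of size $n$ is an $n\times n$ matrix $M=(m_{i,j})$ with entries in $\{0,1\}$ whose support $T=\{(i,j): m_{i,j}=1\}$ (whose elements are called vertices) satisfies: (1) $(1,1)\in T$; (2) for every $p=(i,j)\in T$ with $p\neq(1,1)$, exactly one of the following holds: there is $(i',j)\in T$ with $i'<i$, or there is $(i,j')\in T$ with $j'<j$; (3) every row and every column of $M$ contains at least one vertex; (4) define the parent of $p=(i,j)\neq(1,1)$ to be $(i',j)$ with $i'<i$ maximal if such a vertex exists, and otherwise $(i,j')$ with $j'<j$ maximal; then every vertex is the parent of either zero or exactly two vertices. A vertex with no children is a leaf. The leaf matrix $p(M)$ is obtained from $M$ by replacing all non-leaf vertices by $0$ (it is a permutation matrix). For an $n\times n$ matrix and $k>1$, the $k$-th L-subset is the set of positions $\{(i,j): (i=k \text{ and } j\le k) \text{ or } (j=k \text{ and } i\le k)\}$. *)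

theory Defs
  imports Main
begin

text \<open>An n x n 0/1 matrix is represented by its support: the set of positions (i,j),
  1 \<le> i,j \<le> n (1-based, row i, column j), whose entry is 1.\<close>

definition grid :: "nat \<Rightarrow> (nat \<times> nat) set" where
  "grid n = {1..n} \<times> {1..n}"

definition perm_matrix :: "nat \<Rightarrow> (nat \<times> nat) set \<Rightarrow> bool" where
  "perm_matrix n P \<longleftrightarrow> P \<subseteq> grid n \<and>
     (\<forall>i\<in>{1..n}. \<exists>!j. (i, j) \<in> P) \<and> (\<forall>j\<in>{1..n}. \<exists>!i. (i, j) \<in> P)"

definition parent :: "(nat \<times> nat) set \<Rightarrow> nat \<times> nat \<Rightarrow> nat \<times> nat" where
  "parent T p = (case p of (i, j) \<Rightarrow>
     if \<exists>i'<i. (i', j) \<in> T then (GREATEST i'. i' < i \<and> (i', j) \<in> T, j)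
     else (i, GREATEST j'. j' < j \<and> (i, j') \<in> T))"

definition children :: "(nat \<times> nat) set \<Rightarrow> nat \<times> nat \<Rightarrow> (nat \<times> nat) set" where
  "children T p = {q \<in> T. q \<noteq> (1, 1) \<and> parent T q = p}"

definition is_cnm :: "nat \<Rightarrow> (nat \<times> nat) set \<Rightarrow> bool" where
  "is_cnm n T \<longleftrightarrow> T \<subseteq> grid n \<and>
     (1, 1) \<in> T \<and>
     (\<forall>(i, j)\<in>T. (i, j) \<noteq> (1, 1) \<longrightarrow>
        ((\<exists>i'<i. (i', j) \<in> T) \<noteq> (\<exists>j'<j. (i, j') \<in> T))) \<and>
     (\<forall>i\<in>{1..n}. \<exists>j. (i, j) \<in> T) \<and> (\<forall>j\<in>{1..n}. \<exists>i. (i, j) \<in> T) \<and>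
     (\<forall>p\<in>T. card (children T p) = 0 \<or> card (children T p) = 2)"

definition leaf_matrix :: "(nat \<times> nat) set \<Rightarrow> (nat \<times> nat) set" where
  "leaf_matrix T = {p \<in> T. children T p = {}}"

definition L_subset :: "nat \<Rightarrow> (nat \<times> nat) set" where
  "L_subset k = {(i, j). (i = k \<and> j \<le> k) \<or> (j = k \<and> i \<le> k)}"

end

theory Submission
  imports Defs
begin

text \<open>
  Regard the cells of the Rothe diagram of the permutation as the edges of its inversion graph:
  the cell (i, j) joins the entry of row i to the entry of column j. The internal vertices of a CNM
  with leaf matrix P form a spanning tree of this graph in which no vertex of the CNM has both
  a vertex above it and one to its left. Kruskal's algorithm produces such trees for every order of
  the cells in which the top left corner of a hook precedes the later of its two ends. Two orders
  are used: the lexicographic one, and the lexicographic one with a single cell f moved to the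
  front. If the CNM is unique, the two trees agree, so the tree contains every cell f and the
  inversion graph is itself a tree; (a) and (b) can then be read off.
  Conversely, (a) and (b) say that there are no fixed points and that for every k < n exactly one
  entry in the columns up to k lies below row k, and symmetrically. Then no cell on or below the
  diagonal has a vertex to its left and no cell on or above the diagonal has a vertex above it,
  which forces the CNM to contain all cells of the Rothe diagram.
\<close>

section \<open>Parents and children\<close>

text \<open>The second hypothesis keeps the \<open>GREATEST\<close> in \<open>parent\<close> from
  ranging over an empty set, where its value would be unspecified.\<close>

lemma parentD:
  assumes "parent T (a, b) = (i, j)" and "(\<exists>a'<a. (a', b) \<in> T) \<or> (\<exists>b'<b. (a, b') \<in> T)"
  shows "(i, j) \<in> T \<and> ((j = b \<and> i < a \<and> (\<forall>i'. i < i' \<and> i' < a \<longrightarrow> (i', b) \<notin> T)) \<or>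
                       (i = a \<and> j < b \<and> (\<forall>j'. j < j' \<and> j' < b \<longrightarrow> (a, j') \<notin> T)))"
proof (cases "\<exists>a'<a. (a', b) \<in> T")
  case True
  let ?Q = "\<lambda>i'. i' < a \<and> (i', b) \<in> T"
  from True obtain a' where "?Q a'" by blast
  then have g: "?Q (Greatest ?Q)" and le: "\<And>y. ?Q y \<Longrightarrow> y \<le> Greatest ?Q"
    using GreatestI_nat[of ?Q _ a] Greatest_le_nat[of ?Q _ a] less_imp_le by blast+
  have "i = Greatest ?Q" "j = b" using assms(1) True by (auto simp: parent_def)
  then show ?thesis using g le by (meson not_less)
next
  case False
  let ?Q = "\<lambda>j'. j' < b \<and> (a, j') \<in> T"
  from False assms(2) obtain b' where "?Q b'" by blast
  then have g: "?Q (Greatest ?Q)" and le: "\<And>y. ?Q y \<Longrightarrow> y \<le> Greatest ?Q"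
    using GreatestI_nat[of ?Q _ b] Greatest_le_nat[of ?Q _ b] less_imp_le by blast+
  have "j = Greatest ?Q" "i = a" using assms(1) False by (auto simp: parent_def)
  then show ?thesis using g le by (meson not_less)
qed

lemma parent_above:
  assumes "(i, j) \<in> T" "i < a" "\<And>i'. i < i' \<Longrightarrow> i' < a \<Longrightarrow> (i', j) \<notin> T"
  shows "parent T (a, j) = (i, j)"
proof -
  have "(GREATEST i'. i' < a \<and> (i', j) \<in> T) = i"
    using assms by (intro Greatest_equality) (auto simp: not_less[symmetric])
  then show ?thesis using assms by (auto simp: parent_def)
qed

lemma parent_left:
  assumes "(i, j) \<in> T" "j < b" "\<And>j'. j < j' \<Longrightarrow> j' < b \<Longrightarrow> (i, j') \<notin> T"
    and "\<And>i'. i' < i \<Longrightarrow> (i', b) \<notin> T"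
  shows "parent T (i, b) = (i, j)"
proof -
  have "(GREATEST j'. j' < b \<and> (i, j') \<in> T) = j"
    using assms by (intro Greatest_equality) (auto simp: not_less[symmetric])
  then show ?thesis using assms by (auto simp: parent_def)
qed

lemma cnm_has_up_or_left:
  assumes "is_cnm n T" "(i, j) \<in> T" "(i, j) \<noteq> (1, 1)"
  shows "(\<exists>i'<i. (i', j) \<in> T) \<noteq> (\<exists>j'<j. (i, j') \<in> T)"
  using assms unfolding is_cnm_def by blast

text \<open>A non-leaf has exactly two children. A child below is the next vertex of the column and
  a child to the right the next vertex of the row, so each direction admits at most one child and
  both directions occur.\<close>

lemma cnm_nonleaf_extends:
  assumes T: "is_cnm n T" and p: "(i, j) \<in> T" and ch: "children T (i, j) \<noteq> {}"
  shows "\<exists>b>j. (i, b) \<in> T" "\<exists>a>i. (a, j) \<in> T"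
proof -
  have "finite T"
    using T by (auto simp: is_cnm_def grid_def intro: finite_subset)
  then have "finite (children T (i, j))" by (auto simp: children_def)
  moreover have "card (children T (i, j)) = 0 \<or> card (children T (i, j)) = 2"
    using T p by (auto simp: is_cnm_def)
  ultimately have "card (children T (i, j)) = 2" using ch by auto
  then obtain q r where qr: "children T (i, j) = {q, r}" "q \<noteq> r"
    by (auto simp: card_2_iff)
  have adj: "(a, b) \<in> T \<and>
      ((j = b \<and> i < a \<and> (\<forall>i'. i < i' \<and> i' < a \<longrightarrow> (i', b) \<notin> T)) \<or>
       (i = a \<and> j < b \<and> (\<forall>j'. j < j' \<and> j' < b \<longrightarrow> (a, j') \<notin> T)))"
    if "(a, b) \<in> children T (i, j)" for a b
  proof -
    have "(a, b) \<in> T" "(a, b) \<noteq> (1, 1)" "parent T (a, b) = (i, j)"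
      using that by (auto simp: children_def)
    then show ?thesis
      using parentD[of T a b i j] cnm_has_up_or_left[OF T, of a b] by blast
  qed
  obtain a b a' b' where ab: "q = (a, b)" "r = (a', b')" by (cases q, cases r) auto
  have A: "(a, b) \<in> children T (i, j)" "(a', b') \<in> children T (i, j)" using qr ab by auto
  note B = adj[OF A(1)] adj[OF A(2)]
  have ne: "(a, b) \<noteq> (a', b')" using qr ab by simp
  show "\<exists>b>j. (i, b) \<in> T" using B ne
    by (metis linorder_neqE_nat)
  show "\<exists>a>i. (a, j) \<in> T" using B ne
    by (metis linorder_neqE_nat)
qed

section \<open>CNMs as sets between the leaves and the Rothe diagram\<close>

text \<open>A permutation is kept together with its inverse, so that exchanging \<open>\<pi>\<close>
  and \<open>\<sigma>\<close> transposes the matrix and \<open>swap\<close> yields the mirror image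
  of every fact proved here.\<close>

locale leaves =
  fixes n :: nat and \<pi> \<sigma> :: "nat \<Rightarrow> nat"
  assumes pi_range: "i \<in> {1..n} \<Longrightarrow> \<pi> i \<in> {1..n}"
    and sigma_range: "i \<in> {1..n} \<Longrightarrow> \<sigma> i \<in> {1..n}"
    and sigma_pi: "i \<in> {1..n} \<Longrightarrow> \<sigma> (\<pi> i) = i"
    and pi_sigma: "i \<in> {1..n} \<Longrightarrow> \<pi> (\<sigma> i) = i"
begin

lemma swap: "leaves n \<sigma> \<pi>"
  by unfold_locales (rule pi_range sigma_range sigma_pi pi_sigma; assumption)+

definition lv :: "(nat \<times> nat) set" where
  "lv = {(i, j). i \<in> {1..n} \<and> j \<in> {1..n} \<and> j = \<pi> i}"

definition rothe :: "(nat \<times> nat) set" where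
  "rothe = {(i, j). i \<in> {1..n} \<and> j \<in> {1..n} \<and> j < \<pi> i \<and> i < \<sigma> j}"

lemma lv_iff: "(i, j) \<in> lv \<longleftrightarrow> i \<in> {1..n} \<and> j \<in> {1..n} \<and> j = \<pi> i"
  by (simp add: lv_def)

lemma lv_iff': "(i, j) \<in> lv \<longleftrightarrow> i \<in> {1..n} \<and> j \<in> {1..n} \<and> i = \<sigma> j"
  using sigma_pi pi_sigma by (auto simp: lv_def)

lemma rothe_iff: "(i, j) \<in> rothe \<longleftrightarrow> i \<in> {1..n} \<and> j \<in> {1..n} \<and> j < \<pi> i \<and> i < \<sigma> j"
  by (simp add: rothe_def)

lemma full_bounds:
  assumes "(i, j) \<in> lv \<union> rothe"
  shows "i \<in> {1..n}" "j \<in> {1..n}" "j \<le> \<pi> i" "i \<le> \<sigma> j"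
  using assms sigma_pi by (auto simp: lv_iff rothe_iff)

lemma rothe_swap: "(j, i) \<in> leaves.rothe n \<sigma> \<pi> \<longleftrightarrow> (i, j) \<in> rothe"
  by (auto simp: leaves.rothe_iff[OF swap] rothe_iff)

lemma lv_swap: "(j, i) \<in> leaves.lv n \<sigma> \<longleftrightarrow> (i, j) \<in> lv"
  by (auto simp: leaves.lv_iff[OF swap] lv_iff')

lemma full_swap: "(j, i) \<in> leaves.lv n \<sigma> \<union> leaves.rothe n \<sigma> \<pi> \<longleftrightarrow> (i, j) \<in> lv \<union> rothe"
  using rothe_swap lv_swap by blast

text \<open>The last vertex of a row has nothing to its right, so by
  \<open>cnm_nonleaf_extends\<close> it is a leaf, hence the entry of that row; likewise for
  columns. A vertex that is not strictly before both entries is one of them.\<close>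

lemma cnm_subset_full:
  assumes T: "is_cnm n T" and L: "leaf_matrix T = lv"
  shows "lv \<subseteq> T" "T \<subseteq> lv \<union> rothe"
proof -
  show "lv \<subseteq> T" using L by (auto simp: leaf_matrix_def)
  have grid: "i \<in> {1..n} \<and> j \<in> {1..n}" if "(i, j) \<in> T" for i j
    using T that by (auto simp: is_cnm_def grid_def)
  have nl: "children T (i, j) \<noteq> {}" if "(i, j) \<in> T" "(i, j) \<notin> lv" for i j
    using L that by (auto simp: leaf_matrix_def)
  have row: "j \<le> \<pi> i" if "(i, j) \<in> T" for i j
  proof -
    let ?R = "{b. (i, b) \<in> T}"
    have fin: "finite ?R" using grid by (auto intro: finite_subset[of _ "{1..n}"])
    have ne: "?R \<noteq> {}" using that by auto
    have M: "(i, Max ?R) \<in> T" using Max_in[OF fin ne] by simp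
    have "(i, Max ?R) \<in> lv"
    proof (rule ccontr)
      assume "(i, Max ?R) \<notin> lv"
      then obtain b where "b > Max ?R" "(i, b) \<in> T"
        using cnm_nonleaf_extends(1)[OF T M nl[OF M]] by blast
      then show False using Max_ge[OF fin, of b] by simp
    qed
    then have "Max ?R = \<pi> i" by (simp add: lv_iff)
    then show ?thesis using Max_ge[OF fin, of j] that by simp
  qed
  have col: "i \<le> \<sigma> j" if "(i, j) \<in> T" for i j
  proof -
    let ?R = "{a. (a, j) \<in> T}"
    have fin: "finite ?R" using grid by (auto intro: finite_subset[of _ "{1..n}"])
    have ne: "?R \<noteq> {}" using that by auto
    have M: "(Max ?R, j) \<in> T" using Max_in[OF fin ne] by simp
    have "(Max ?R, j) \<in> lv"
    proof (rule ccontr)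
      assume "(Max ?R, j) \<notin> lv"
      then obtain a where "a > Max ?R" "(a, j) \<in> T"
        using cnm_nonleaf_extends(2)[OF T M nl[OF M]] by blast
      then show False using Max_ge[OF fin, of a] by simp
    qed
    then have "Max ?R = \<sigma> j" by (simp add: lv_iff')
    then show ?thesis using Max_ge[OF fin, of i] that by simp
  qed
  show "T \<subseteq> lv \<union> rothe"
  proof (clarify)
    fix i j assume t: "(i, j) \<in> T" and nr: "(i, j) \<notin> rothe"
    have "j = \<pi> i \<or> i = \<sigma> j" using nr grid[OF t] row[OF t] col[OF t] by (auto simp: rothe_iff)
    then show "(i, j) \<in> lv" using grid[OF t] lv_iff[of i j] lv_iff'[of i j] by blast
  qed
qed

text \<open>This reduces the construction of CNMs to the exactly-one condition. Beyond a Rothe cell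
  lie the entries of its row and column, so there is a next vertex to the right and one below, and
  these are its two children; beyond a leaf there is nothing.\<close>

lemma cnm_criterion:
  assumes B: "B \<subseteq> rothe" and T: "T = lv \<union> B" and root: "(1, 1) \<in> T"
    and ex1: "\<And>i j. (i, j) \<in> T \<Longrightarrow> (i, j) \<noteq> (1, 1) \<Longrightarrow>
        (\<exists>i'<i. (i', j) \<in> T) \<noteq> (\<exists>j'<j. (i, j') \<in> T)"
    and n: "(1, 1) \<notin> lv"
  shows "is_cnm n T" "leaf_matrix T = lv"
proof -
  have full: "(i, j) \<in> lv \<union> rothe" if "(i, j) \<in> T" for i j using that B T by blast
  have adj: "(a, b) \<in> T \<and> (i, j) \<in> T \<and>
      ((j = b \<and> i < a \<and> (\<forall>i'. i < i' \<and> i' < a \<longrightarrow> (i', b) \<notin> T)) \<or>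
       (i = a \<and> j < b \<and> (\<forall>j'. j < j' \<and> j' < b \<longrightarrow> (a, j') \<notin> T)))"
    if "(a, b) \<in> children T (i, j)" for a b i j
  proof -
    have "(a, b) \<in> T" "(a, b) \<noteq> (1, 1)" "parent T (a, b) = (i, j)"
      using that by (auto simp: children_def)
    then show ?thesis
      using parentD[of T a b i j] ex1[of a b] by blast
  qed
  have leaf: "children T (i, j) = {}" if "(i, j) \<in> lv" for i j
  proof (rule ccontr)
    assume "children T (i, j) \<noteq> {}"
    then obtain a b where ab: "(a, b) \<in> children T (i, j)" by auto
    note A = adj[OF ab]
    have "a \<le> \<sigma> b" "b \<le> \<pi> a" using full_bounds[OF full] A by blast+
    moreover have "j = \<pi> i" "i = \<sigma> j" using that lv_iff lv_iff' by blast+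
    ultimately show False using A by auto
  qed
  have two: "card (children T (i, j)) = 2" if "(i, j) \<in> B" for i j
  proof -
    have p: "(i, j) \<in> T" "(i, j) \<in> rothe" using that B T by auto
    have r: "i \<in> {1..n}" "j \<in> {1..n}" "j < \<pi> i" "i < \<sigma> j" using p(2) by (auto simp: rothe_iff)
    have "(i, \<pi> i) \<in> T" "(\<sigma> j, j) \<in> T" using r pi_range sigma_range pi_sigma T
      by (auto simp: lv_iff)
    then have exb: "\<exists>b. j < b \<and> (i, b) \<in> T" and exa: "\<exists>a. i < a \<and> (a, j) \<in> T" using r by auto
    define b where "b = (LEAST b. j < b \<and> (i, b) \<in> T)"
    define a where "a = (LEAST a. i < a \<and> (a, j) \<in> T)"
    have b: "j < b" "(i, b) \<in> T" "\<And>b'. j < b' \<Longrightarrow> b' < b \<Longrightarrow> (i, b') \<notin> T"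
      using LeastI_ex[OF exb] not_less_Least[of _ "\<lambda>b. j < b \<and> (i, b) \<in> T"]
      unfolding b_def by blast+
    have a: "i < a" "(a, j) \<in> T" "\<And>a'. i < a' \<Longrightarrow> a' < a \<Longrightarrow> (a', j) \<notin> T"
      using LeastI_ex[OF exa] not_less_Least[of _ "\<lambda>a. i < a \<and> (a, j) \<in> T"]
      unfolding a_def by blast+
    have nr: "(i, b) \<noteq> (1, 1)" "(a, j) \<noteq> (1, 1)" using a(1) b(1) r by auto
    have noup: "(i', b) \<notin> T" if "i' < i" for i'
      using ex1[OF b(2) nr(1)] b(1) p(1) that by blast
    have "parent T (i, b) = (i, j)" using parent_left[OF p(1) b(1) b(3) noup] by blast
    moreover have "parent T (a, j) = (i, j)" using parent_above[OF p(1) a(1) a(3)] by blast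
    ultimately have sub: "{(i, b), (a, j)} \<subseteq> children T (i, j)"
      using a b nr by (auto simp: children_def)
    moreover have "children T (i, j) \<subseteq> {(i, b), (a, j)}"
    proof
      fix q assume "q \<in> children T (i, j)"
      moreover obtain a' b' where q: "q = (a', b')" by (cases q)
      ultimately have "(a', b') \<in> T \<and> (i, j) \<in> T \<and>
        ((j = b' \<and> i < a' \<and> (\<forall>i'. i < i' \<and> i' < a' \<longrightarrow> (i', b') \<notin> T)) \<or>
         (i = a' \<and> j < b' \<and> (\<forall>j'. j < j' \<and> j' < b' \<longrightarrow> (a', j') \<notin> T)))" using adj by simp
      then have "(a' = a \<and> b' = j) \<or> (a' = i \<and> b' = b)"
        using a b by (metis linorder_neqE_nat)
      then show "q \<in> {(i, b), (a, j)}" using q by auto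
    qed
    ultimately have "children T (i, j) = {(i, b), (a, j)}" by blast
    then show ?thesis using a b by simp
  qed
  have cover: "(i, \<pi> i) \<in> T \<and> (\<sigma> i, i) \<in> T" if "i \<in> {1..n}" for i
    using that pi_range sigma_range pi_sigma T by (auto simp: lv_iff)
  show "is_cnm n T"
    unfolding is_cnm_def
  proof (intro conjI)
    show "T \<subseteq> grid n" using full_bounds(1,2)[OF full] unfolding grid_def by auto
    show "\<forall>(i, j)\<in>T. (i, j) \<noteq> (1, 1) \<longrightarrow>
        (\<exists>i'<i. (i', j) \<in> T) \<noteq> (\<exists>j'<j. (i, j') \<in> T)" using ex1 by blast
    show "\<forall>i\<in>{1..n}. \<exists>j. (i, j) \<in> T" using cover by blast
    show "\<forall>j\<in>{1..n}. \<exists>i. (i, j) \<in> T" using cover by blast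
    show "\<forall>p\<in>T. card (children T p) = 0 \<or> card (children T p) = 2"
    proof
      fix p assume p: "p \<in> T"
      obtain i j where ij: "p = (i, j)" by (cases p)
      have "(i, j) \<in> lv \<or> (i, j) \<in> B" using p ij T by simp
      then show "card (children T p) = 0 \<or> card (children T p) = 2" using leaf two ij by auto
    qed
  qed (fact root)
  show "leaf_matrix T = lv"
  proof
    show "leaf_matrix T \<subseteq> lv"
    proof clarify
      fix i j assume "(i, j) \<in> leaf_matrix T"
      then have "(i, j) \<in> T" "children T (i, j) = {}" by (auto simp: leaf_matrix_def)
      then show "(i, j) \<in> lv" using two T by force
    qed
    show "lv \<subseteq> leaf_matrix T" using leaf T by (auto simp: leaf_matrix_def)
  qed
qed

section \<open>Connectivity of the inversion graph\<close>

text \<open>An entry of the permutation matrix is identified with its row.\<close>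

definition links :: "(nat \<times> nat) set \<Rightarrow> (nat \<times> nat) set" where
  "links B = {(i, \<sigma> j) |i j. (i, j) \<in> B} \<union> {(\<sigma> j, i) |i j. (i, j) \<in> B}"

lemma links_sym: "(x, y) \<in> (links B)\<^sup>* \<Longrightarrow> (y, x) \<in> (links B)\<^sup>*"
  by (rule symD[OF sym_rtrancl]) (auto simp: links_def sym_def)

lemma linksI: "(i, j) \<in> B \<Longrightarrow> (i, \<sigma> j) \<in> (links B)\<^sup>*"
  by (rule r_into_rtrancl) (auto simp: links_def)

text \<open>Induction on \<open>i + j\<close>: a vertex other than the root shares its row or column
  with an earlier vertex, so one of its two ends is already joined to 1, and the vertex itself joins
  the other.\<close>

lemma cnm_connected:
  assumes T: "is_cnm n T" and L: "leaf_matrix T = lv" and "r \<in> {1..n}"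
  shows "(1, r) \<in> (links rothe)\<^sup>*"
proof -
  have sub: "T \<subseteq> lv \<union> rothe" "lv \<subseteq> T" using cnm_subset_full[OF T L] by auto
  \<comment> \<open>For a leaf \<open>i = \<sigma> j\<close>, and the path is empty.\<close>
  have edge: "(i, \<sigma> j) \<in> (links rothe)\<^sup>*" if "(i, j) \<in> T" for i j
    using that sub linksI[of i j rothe] by (auto simp: lv_iff')
  have "(i, j) \<in> T \<Longrightarrow> (1, i) \<in> (links rothe)\<^sup>* \<and> (1, \<sigma> j) \<in> (links rothe)\<^sup>*" for i j
  proof (induction "i + j" arbitrary: i j rule: less_induct)
    case less
    show ?case
    proof (cases "(i, j) = (1, 1)")
      case True
      then show ?thesis using edge[of 1 1] less.prems by auto
    next
      case False
      then consider i' where "i' < i" "(i', j) \<in> T" | j' where "j' < j" "(i, j') \<in> T"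
        using cnm_has_up_or_left[OF T less.prems] by blast
      then show ?thesis
      proof cases
        case 1
        then have "(1, \<sigma> j) \<in> (links rothe)\<^sup>*" using less.hyps[of i' j] by auto
        then show ?thesis using links_sym[OF edge[OF less.prems]] by (auto intro: rtrancl_trans)
      next
        case 2
        then have "(1, i) \<in> (links rothe)\<^sup>*" using less.hyps[of i j'] by auto
        then show ?thesis using edge[OF less.prems] by (auto intro: rtrancl_trans)
      qed
    qed
  qed
  moreover have "(r, \<pi> r) \<in> T" using sub assms(3) pi_range by (auto simp: lv_iff)
  ultimately show ?thesis by blast
qed

text \<open>An injection of the finite set \<open>{1..k}\<close> into itself is onto, so its inverse
  preserves the set as well.\<close>

lemma block_swap:
  assumes "k \<le> n" "\<forall>i\<in>{1..k}. \<pi> i \<le> k" and "j \<in> {1..k}"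
  shows "\<sigma> j \<le> k"
proof -
  have inj: "inj_on \<pi> {1..k}" using assms(1) sigma_pi
    by (intro inj_on_inverseI[where g = \<sigma>]) auto
  have "\<pi> ` {1..k} \<subseteq> {1..k}" using assms pi_range by fastforce
  then have "\<pi> ` {1..k} = {1..k}" using inj by (intro endo_inj_surj) auto
  then obtain i where "i \<in> {1..k}" "\<pi> i = j" using assms(3) by (metis imageE)
  then show ?thesis using sigma_pi[of i] assms(1) by auto
qed

text \<open>If no entry of the first k rows lay beyond column k, then by \<open>block_swap\<close>
  the same would hold with rows and columns exchanged. The first k entries would be closed under
  links, and n could not be reached from 1.\<close>

lemma connected_crossing:
  assumes conn: "(1, n) \<in> (links rothe)\<^sup>*" and k: "1 \<le> k" "k < n"
  shows "\<exists>i\<in>{1..k}. k < \<pi> i" "\<exists>j\<in>{1..k}. k < \<sigma> j"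
proof -
  have no: False if A: "\<forall>i\<in>{1..k}. \<pi> i \<le> k" and C: "\<forall>j\<in>{1..k}. \<sigma> j \<le> k"
  proof -
    have "y \<in> {1..k}" if "(1, y) \<in> (links rothe)\<^sup>*" for y
      using that
    proof (induction rule: rtrancl_induct)
      case base
      then show ?case using k by simp
    next
      case (step y z)
      from step.hyps(2) consider j where "(y, j) \<in> rothe" "z = \<sigma> j"
        | j where "(z, j) \<in> rothe" "y = \<sigma> j"
        by (auto simp: links_def)
      then show ?case
      proof cases
        case 1
        then have "j \<in> {1..n}" "j < \<pi> y" by (auto simp: rothe_iff)
        moreover have "\<pi> y \<le> k" using A step.IH by auto
        ultimately have "j \<in> {1..k}" "\<sigma> j \<ge> 1" using sigma_range[of j] by auto
        then show ?thesis using C 1 by auto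
      next
        case 2
        then show ?thesis using step.IH by (auto simp: rothe_iff)
      qed
    qed
    then show False using conn k by fastforce
  qed
  have "(\<forall>i\<in>{1..k}. \<pi> i \<le> k) \<longleftrightarrow> (\<forall>j\<in>{1..k}. \<sigma> j \<le> k)"
    using block_swap leaves.block_swap[OF swap] k by (meson less_imp_le)
  then show "\<exists>i\<in>{1..k}. k < \<pi> i" "\<exists>j\<in>{1..k}. k < \<sigma> j" using no by (meson not_less)+
qed

lemma connected_has_up_or_left:
  assumes B: "B \<subseteq> rothe" and T: "T = lv \<union> B" and root: "(1, 1) \<in> T"
    and conn: "\<And>r. r \<in> {1..n} \<Longrightarrow> (1, r) \<in> (links B)\<^sup>*"
    and both: "\<And>i j i' j'. (i, j) \<in> T \<Longrightarrow> (i', j) \<in> T \<Longrightarrow> (i, j') \<in> T \<Longrightarrow> i' < i \<Longrightarrow> j' < j \<Longrightarrow> False"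
    and p: "(i, j) \<in> T" "(i, j) \<noteq> (1, 1)"
  shows "(\<exists>i'<i. (i', j) \<in> T) \<noteq> (\<exists>j'<j. (i, j') \<in> T)"
proof -
  \<comment> \<open>The vertices reached from the root by steps down or right are closed under sharing a row or
    column with a reached vertex, hence by connectivity they are all of T.\<close>
  define K where "K = lfp (\<lambda>X. {(i, j). (i, j) \<in> T \<and> ((i, j) = (1, 1) \<or>
      (\<exists>i'<i. (i', j) \<in> X) \<or> (\<exists>j'<j. (i, j') \<in> X))})"
  have "mono (\<lambda>X. {(i, j). (i, j) \<in> T \<and> ((i, j) = (1, 1) \<or>
      (\<exists>i'<i. (i', j) \<in> X) \<or> (\<exists>j'<j. (i, j') \<in> X))})"
    by (rule monoI) blast
  note K_unf = lfp_unfold[OF this, folded K_def]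
  have K: "(i, j) \<in> K \<longleftrightarrow> (i, j) \<in> T \<and> ((i, j) = (1, 1) \<or>
      (\<exists>i'<i. (i', j) \<in> K) \<or> (\<exists>j'<j. (i, j') \<in> K))" for i j
    by (subst K_unf) simp
  have pos: "1 \<le> a \<and> 1 \<le> b" if "(a, b) \<in> T" for a b
    using that B T full_bounds(1,2)[of a b] by auto
  \<comment> \<open>Vertices to the right and below are in \<open>K\<close> by its definition. If
    \<open>(i, j)\<close> was reached from above, \<open>both\<close> leaves nothing to its left,
    and the rest of the column follows by induction at the vertex above; symmetrically if it was
    reached from the left.\<close>
  have line: "(i, j) \<in> K \<Longrightarrow> (\<forall>b. (i, b) \<in> T \<longrightarrow> (i, b) \<in> K) \<and> (\<forall>a. (a, j) \<in> T \<longrightarrow> (a, j) \<in> K)" for i j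
  proof (induction "i + j" arbitrary: i j rule: less_induct)
    case less
    have t: "(i, j) \<in> T" using less.prems K by blast
    have right: "(i, b) \<in> K" if "(i, b) \<in> T" "j < b" for b using that less.prems K by blast
    have down: "(a, j) \<in> K" if "(a, j) \<in> T" "i < a" for a using that less.prems K by blast
    from less.prems consider "(i, j) = (1, 1)" | i' where "i' < i" "(i', j) \<in> K"
      | j' where "j' < j" "(i, j') \<in> K" using K[of i j] by blast
    then show ?case
    proof cases
      case 1
      then show ?thesis using pos right down less.prems by (metis Pair_inject le_neq_implies_less)
    next
      case 2
      have "i' + j < i + j" using 2(1) by simp
      then have c: "\<forall>a. (a, j) \<in> T \<longrightarrow> (a, j) \<in> K" using less.hyps 2(2) by blast
      have "\<not> j' < j" if "(i, j') \<in> T" for j' using both[OF t _ that 2(1)] 2(2) K[of i' j] by blast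
      then show ?thesis using c right less.prems by (metis linorder_neqE_nat)
    next
      case 3
      have "i + j' < i + j" using 3(1) by simp
      then have c: "\<forall>b. (i, b) \<in> T \<longrightarrow> (i, b) \<in> K" using less.hyps 3(2) by blast
      have "\<not> i' < i" if "(i', j) \<in> T" for i' using both[OF t that _ _ 3(1)] 3(2) K[of i j'] by blast
      then show ?thesis using c down less.prems by (metis linorder_neqE_nat)
    qed
  qed
  have lvT: "(r, \<pi> r) \<in> T" if "r \<in> {1..n}" for r using that T pi_range by (auto simp: lv_iff)
  have lvT': "(\<sigma> r, r) \<in> T" if "r \<in> {1..n}" for r using that T sigma_range by (auto simp: lv_iff')
  \<comment> \<open>A link runs from one entry along a row to a cell and along its column to the
    next entry, or the other way round; \<open>line\<close> covers both halves.\<close>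
  have reach: "(r, \<pi> r) \<in> K" if "(1, r) \<in> (links B)\<^sup>*" for r
    using that
  proof (induction rule: rtrancl_induct)
    case base
    have "1 \<in> {1..n}" using full_bounds(1)[of 1 1] root B T by blast
    then show ?case using line[of 1 1] K[of 1 1] root lvT by blast
  next
    case (step y z)
    from step.hyps(2) consider j where "(y, j) \<in> B" "z = \<sigma> j" | j where "(z, j) \<in> B" "y = \<sigma> j"
      by (auto simp: links_def)
    then show ?case
    proof cases
      case 1
      then have j: "j \<in> {1..n}" using B by (auto simp: rothe_iff)
      have "(y, j) \<in> K" using line[OF step.IH] 1 T by blast
      then have "(\<sigma> j, j) \<in> K" using line lvT'[OF j] by blast
      then show ?thesis using 1 pi_sigma[OF j] by simp
    next
      case 2
      then have j: "j \<in> {1..n}" "z \<in> {1..n}" using B by (auto simp: rothe_iff)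
      have "(\<sigma> j, j) \<in> K" using step.IH 2 pi_sigma[OF j(1)] by simp
      then have "(z, j) \<in> K" using line 2 T by blast
      then show ?thesis using line lvT[OF j(2)] by blast
    qed
  qed
  have "i \<in> {1..n}" using full_bounds(1)[of i j] p B T by blast
  then have "(i, j) \<in> K" using reach conn line p by blast
  then have "(\<exists>i'<i. (i', j) \<in> T) \<or> (\<exists>j'<j. (i, j') \<in> T)" using K p by blast
  then show ?thesis using both p by blast
qed

section \<open>CNMs from Kruskal's algorithm\<close>

text \<open>Comparing with the connectivity of all earlier cells, not only of the accepted ones,
  gives the same set and avoids a recursion.\<close>

definition kruskal :: "(nat \<times> nat \<Rightarrow> nat) \<Rightarrow> (nat \<times> nat) set" where
  "kruskal \<rho> = {(i, j). (i, j) \<in> rothe \<and> (i, \<sigma> j) \<notin> (links {e \<in> rothe. \<rho> e < \<rho> (i, j)})\<^sup>*}"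

text \<open>Induction on the rank: a rejected cell joins two entries that are connected through
  earlier cells, and each of those can be replaced by a path of accepted cells.\<close>

lemma kruskal_connected: "(links rothe)\<^sup>* \<subseteq> (links (kruskal \<rho>))\<^sup>*"
proof -
  have edge: "(i, j) \<in> rothe \<Longrightarrow> (i, \<sigma> j) \<in> (links (kruskal \<rho>))\<^sup>*" for i j
  proof (induction "\<rho> (i, j)" arbitrary: i j rule: less_induct)
    case less
    show ?case
    proof (cases "(i, j) \<in> kruskal \<rho>")
      case True
      then show ?thesis by (rule linksI)
    next
      case False
      then have c: "(i, \<sigma> j) \<in> (links {e \<in> rothe. \<rho> e < \<rho> (i, j)})\<^sup>*"
        using less.prems by (simp add: kruskal_def)
      have "links {e \<in> rothe. \<rho> e < \<rho> (i, j)} \<subseteq> (links (kruskal \<rho>))\<^sup>*"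
        using less.hyps links_sym by (fastforce simp: links_def)
      then show ?thesis using c rtrancl_subset_rtrancl by blast
    qed
  qed
  have "links rothe \<subseteq> (links (kruskal \<rho>))\<^sup>*"
    using edge links_sym by (fastforce simp: links_def)
  then show ?thesis by (rule rtrancl_subset_rtrancl)
qed

lemma kruskal_not_both:
  assumes inj: "inj_on \<rho> rothe"
    and \<rho>: "\<And>i j i' j'. \<lbrakk>(i', j) \<in> rothe; (i, j') \<in> rothe; i' < i; j' < j\<rbrakk> \<Longrightarrow>
        \<rho> (i', j') < max (\<rho> (i', j)) (\<rho> (i, j'))"
    and p: "(i, j) \<in> lv \<union> kruskal \<rho>" and u: "(i', j) \<in> lv \<union> kruskal \<rho>"
    and l: "(i, j') \<in> lv \<union> kruskal \<rho>" and lt: "i' < i" "j' < j"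
  shows False
proof -
  have sub: "kruskal \<rho> \<subseteq> rothe" by (auto simp: kruskal_def)
  note fb = full_bounds[of i j] full_bounds[of i' j] full_bounds[of i j']
  have bd: "i \<le> \<sigma> j" "j \<le> \<pi> i" using fb(3,4) p sub by blast+
  \<comment> \<open>A leaf is the last vertex of its row and column, so neither of the two outer
    vertices is a leaf.\<close>
  have u': "(i', j) \<in> kruskal \<rho>" using u bd lt by (auto simp: lv_iff')
  have l': "(i, j') \<in> kruskal \<rho>" using l bd lt by (auto simp: lv_iff)
  have ur: "(i', j) \<in> rothe" "(i, j') \<in> rothe" using u' l' sub by auto
  then have ar: "(i', j') \<in> rothe" using lt by (auto simp: rothe_iff)
  have amax: "\<rho> (i', j') < max (\<rho> (i', j)) (\<rho> (i, j'))" using \<rho>[OF ur lt] .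
  have inj_ne: "\<rho> x \<noteq> \<rho> y" if "x \<in> rothe" "y \<in> rothe" "x \<noteq> y" for x y
    using inj that by (auto dest: inj_onD)
  define F where "F r = (links {e \<in> rothe. \<rho> e < r})\<^sup>*" for r
  have FI: "(a, \<sigma> b) \<in> F r" "(\<sigma> b, a) \<in> F r" if "(a, b) \<in> rothe" "\<rho> (a, b) < r" for a b r
    using that linksI[of a b "{e \<in> rothe. \<rho> e < r}"] links_sym unfolding F_def by blast+
  have Ftr: "(x, z) \<in> F r" if "(x, y) \<in> F r" "(y, z) \<in> F r" for x y z r
    using that unfolding F_def by (rule rtrancl_trans)
  have notF: "(a, \<sigma> b) \<notin> F (\<rho> (a, b))" if "(a, b) \<in> kruskal \<rho>" for a b
    using that by (auto simp: kruskal_def F_def)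
  have d: "i = \<sigma> j \<or> (i, j) \<in> kruskal \<rho>" using p by (auto simp: lv_iff')
  \<comment> \<open>The premise is conditional so that a leaf, whose two ends coincide, is covered
    together with an accepted cell.\<close>
  have dF: "(i, \<sigma> j) \<in> F r" "(\<sigma> j, i) \<in> F r" if "(i, j) \<in> kruskal \<rho> \<Longrightarrow> \<rho> (i, j) < r" for r
    using d that FI[of i j r] sub unfolding F_def by auto
  have ne: "\<rho> (i', j) \<noteq> \<rho> (i, j')"
    "(i, j) \<in> kruskal \<rho> \<Longrightarrow> \<rho> (i', j) \<noteq> \<rho> (i, j) \<and> \<rho> (i, j') \<noteq> \<rho> (i, j)"
    using inj_ne ur lt sub by auto
  \<comment> \<open>The three vertices and the corner (i', j') close a cycle (a triangle if (i, j) is a leaf), and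
    the corner is not its last cell; so the last one would have been rejected.\<close>
  consider "(i, j) \<in> kruskal \<rho>" "\<rho> (i', j) < \<rho> (i, j)" "\<rho> (i, j') < \<rho> (i, j)"
    | "(i, j) \<in> kruskal \<rho> \<Longrightarrow> \<rho> (i, j) < \<rho> (i', j)" "\<rho> (i, j') < \<rho> (i', j)"
    | "(i, j) \<in> kruskal \<rho> \<Longrightarrow> \<rho> (i, j) < \<rho> (i, j')" "\<rho> (i', j) < \<rho> (i, j')"
    using ne by (cases "(i, j) \<in> kruskal \<rho>") (auto simp: nat_neq_iff dest: order_less_trans)
  then show False
  proof cases
    case 1
    let ?r = "\<rho> (i, j)"
    have "(i, \<sigma> j') \<in> F ?r" "(\<sigma> j', i') \<in> F ?r" "(i', \<sigma> j) \<in> F ?r"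
      using FI ur ar 1 amax by auto
    then show False using notF[OF 1(1)] Ftr by blast
  next
    case 2
    let ?r = "\<rho> (i', j)"
    have "(i', \<sigma> j') \<in> F ?r" "(\<sigma> j', i) \<in> F ?r" "(i, \<sigma> j) \<in> F ?r"
      using FI dF ur ar 2 amax by auto
    then show False using notF[OF u'] Ftr by blast
  next
    case 3
    let ?r = "\<rho> (i, j')"
    have "(i, \<sigma> j) \<in> F ?r" "(\<sigma> j, i') \<in> F ?r" "(i', \<sigma> j') \<in> F ?r"
      using FI dF ur ar 3 amax by auto
    then show False using notF[OF l'] Ftr by blast
  qed
qed

lemma kruskal_cnm:
  assumes inj: "inj_on \<rho> rothe"
    and \<rho>: "\<And>i j i' j'. \<lbrakk>(i', j) \<in> rothe; (i, j') \<in> rothe; i' < i; j' < j\<rbrakk> \<Longrightarrow>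
        \<rho> (i', j') < max (\<rho> (i', j)) (\<rho> (i, j'))"
    and root: "(1, 1) \<in> kruskal \<rho>"
    and conn: "\<And>r. r \<in> {1..n} \<Longrightarrow> (1, r) \<in> (links rothe)\<^sup>*"
  shows "is_cnm n (lv \<union> kruskal \<rho>)" "leaf_matrix (lv \<union> kruskal \<rho>) = lv"
proof -
  let ?T = "lv \<union> kruskal \<rho>"
  have sub: "kruskal \<rho> \<subseteq> rothe" by (auto simp: kruskal_def)
  have conn': "(1, r) \<in> (links (kruskal \<rho>))\<^sup>*" if "r \<in> {1..n}" for r
    using conn[OF that] kruskal_connected by blast
  have rT: "(1, 1) \<in> ?T" using root by simp
  have nl: "(1, 1) \<notin> lv" using root sub by (auto simp: lv_iff rothe_iff)
  have A: "(\<exists>i'<i. (i', j) \<in> ?T) \<noteq> (\<exists>j'<j. (i, j') \<in> ?T)"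
    if "(i, j) \<in> ?T" "(i, j) \<noteq> (1, 1)" for i j
    using kruskal_not_both[OF inj \<rho>]
    by (intro connected_has_up_or_left[OF sub refl rT conn' _ that]) blast+
  show "is_cnm n ?T" "leaf_matrix ?T = lv"
    using cnm_criterion[OF sub refl rT A nl] by blast+
qed

section \<open>Uniqueness forces all Rothe cells into the CNM\<close>

text \<open>The inversion graph is simple: the row of a cell is the smaller of its two ends, so the
  ends determine the cell, and a single edge cannot join the ends of another cell.\<close>

lemma links_singleton:
  assumes d: "(i, j) \<in> rothe" "(i, \<sigma> j) \<in> (links X)\<^sup>*" "X \<subseteq> {f}" "f \<in> rothe"
  shows "(i, j) = f"
proof -
  obtain a b where f: "f = (a, b)" by (cases f)
  have ab: "a \<in> {1..n}" "b \<in> {1..n}" "a < \<sigma> b" using assms(4) f by (auto simp: rothe_iff)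
  have ij: "i \<in> {1..n}" "j \<in> {1..n}" "i < \<sigma> j" using assms(1) by (auto simp: rothe_iff)
  have "links X \<subseteq> {(a, \<sigma> b), (\<sigma> b, a)}" using assms(3) f by (auto simp: links_def)
  then have "(i, \<sigma> j) \<in> {(a, \<sigma> b), (\<sigma> b, a)}\<^sup>*" using d(2) rtrancl_mono by blast
  then have "\<sigma> j = i \<or> {i, \<sigma> j} \<subseteq> {a, \<sigma> b}"
    by (induction rule: rtrancl_induct) auto
  then have "i = a" "\<sigma> j = \<sigma> b" using ij ab by auto
  then show ?thesis using f pi_sigma ab ij by metis
qed

text \<open>The cell f is first in some admissible order, hence accepted, and uniqueness identifies
  the resulting CNM with \<open>T\<close>. For the root cell the lexicographic order serves, for any
  other cell the order with f moved to the front.\<close>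

lemma unique_cnm_contains_rothe:
  assumes T: "is_cnm n T" "leaf_matrix T = lv" and n: "2 \<le> n"
    and uniq: "\<And>T'. is_cnm n T' \<Longrightarrow> leaf_matrix T' = lv \<Longrightarrow> T' = T"
  shows "rothe \<subseteq> T"
proof
  fix f assume f: "f \<in> rothe"
  have conn: "(1, r) \<in> (links rothe)\<^sup>*" if "r \<in> {1..n}" for r
    using cnm_connected[OF T that] .
  have "1 < \<pi> 1" "1 < \<sigma> 1" using connected_crossing[of 1] conn[of n] n by auto
  then have root: "(1, 1) \<in> rothe" using n by (auto simp: rothe_iff)
  \<comment> \<open>Columns are at most n, so the factor \<open>n + 1\<close> makes this the
    lexicographic order. All ranks of cells are positive, which leaves 0 free for f without losing
    injectivity.\<close>
  define \<rho> :: "nat \<times> nat \<Rightarrow> nat" where "\<rho> = (\<lambda>(i, j). i * (n + 1) + j)"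
  define \<rho>' where "\<rho>' = \<rho>(f := 0)"
  have pos: "0 < \<rho> e" if "e \<in> rothe" for e using that by (auto simp: \<rho>_def rothe_def)
  have lex: "\<rho> (i, j) < \<rho> (i', j')"
    if "(i, j) \<in> rothe" "i < i' \<or> i = i' \<and> j < j'" for i j i' j'
  proof (cases "i < i'")
    case True
    then have "(i + 1) * (n + 1) \<le> i' * (n + 1)" by (intro mult_right_mono) auto
    moreover have "j \<le> n" using that by (simp add: rothe_iff)
    ultimately show ?thesis by (simp add: \<rho>_def)
  qed (use that in \<open>auto simp: \<rho>_def\<close>)
  have inj: "inj_on \<rho> rothe"
  proof (rule inj_onI, clarify)
    fix i j i' j' assume A: "(i, j) \<in> rothe" "(i', j') \<in> rothe" "\<rho> (i, j) = \<rho> (i', j')"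
    show "i = i' \<and> j = j'" using lex[OF A(1), of i' j'] lex[OF A(2), of i j] A(3)
      by (metis linorder_neqE_nat nat_neq_iff)
  qed
  have corner: "(i', j') \<in> rothe" if "(i', j) \<in> rothe" "(i, j') \<in> rothe" "i' < i" "j' < j" for i j i' j'
    using that by (auto simp: rothe_iff)
  have root_lt: "\<rho> e \<ge> \<rho> (1, 1)" if "e \<in> rothe" for e
  proof -
    obtain i j where e: "e = (i, j)" by (cases e)
    have "1 * (n + 1) \<le> i * (n + 1)" "1 \<le> j"
      using that e by (auto simp: rothe_iff simp del: mult_Suc_right)
    then show ?thesis by (simp add: \<rho>_def e)
  qed
  have root0: "(1, 1) \<in> kruskal \<rho>"
  proof -
    have "{e \<in> rothe. \<rho> e < \<rho> (1, 1)} = {}" using root_lt by (auto simp: not_less)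
    then have "links {e \<in> rothe. \<rho> e < \<rho> (1, 1)} = {}" by (simp add: links_def)
    then show ?thesis using root \<open>1 < \<sigma> 1\<close> by (simp add: kruskal_def)
  qed
  have step0: "\<rho> (i', j') < max (\<rho> (i', j)) (\<rho> (i, j'))"
    if "(i', j) \<in> rothe" "(i, j') \<in> rothe" "i' < i" "j' < j" for i j i' j'
    using lex[OF corner[OF that], of i j'] that(3) by (simp add: less_max_iff_disj)
  have "is_cnm n (lv \<union> kruskal \<rho>) \<and> leaf_matrix (lv \<union> kruskal \<rho>) = lv"
    using step0 conn by (intro conjI kruskal_cnm[OF inj _ root0]) blast+
  then have T0: "lv \<union> kruskal \<rho> = T" using uniq by blast
  have inj': "inj_on \<rho>' rothe"
    using inj pos unfolding \<rho>'_def inj_on_def by (metis fun_upd_apply less_irrefl)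
  show "f \<in> T"
  proof (cases "f = (1, 1)")
    case True
    then show ?thesis using root0 T0 by blast
  next
    case False
    \<comment> \<open>Only f can precede the root cell, and by \<open>links_singleton\<close> it
      does not cause its rejection.\<close>
    have "{e \<in> rothe. \<rho>' e < \<rho>' (1, 1)} \<subseteq> {f}"
    proof
      fix e assume "e \<in> {e \<in> rothe. \<rho>' e < \<rho>' (1, 1)}"
      then show "e \<in> {f}" using root_lt[of e] False by (cases "e = f") (auto simp: \<rho>'_def)
    qed
    then have root1: "(1, 1) \<in> kruskal \<rho>'"
      using links_singleton[OF root _ _ f] False root by (auto simp: kruskal_def)
    have step: "\<rho>' (i', j') < max (\<rho>' (i', j)) (\<rho>' (i, j'))"
      if "(i', j) \<in> rothe" "(i, j') \<in> rothe" "i' < i" "j' < j" for i j i' j'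
    \<comment> \<open>The corner is compared with an end different from f, whose rank is still
      lexicographic: the upper end if possible, otherwise the lower one. If f is the corner itself,
      its rank has only decreased.\<close>
    proof (cases "(i', j) = f")
      case True
      then have "(i, j') \<noteq> f" using that by auto
      then show ?thesis using lex[OF corner[OF that], of i j'] that
        by (auto simp: \<rho>'_def less_max_iff_disj)
    next
      case False
      then show ?thesis using lex[OF corner[OF that], of i' j] that
        by (auto simp: \<rho>'_def less_max_iff_disj)
    qed
    have "is_cnm n (lv \<union> kruskal \<rho>') \<and> leaf_matrix (lv \<union> kruskal \<rho>') = lv"
      using step conn by (intro conjI kruskal_cnm[OF inj' _ root1]) blast+
    moreover have "f \<in> kruskal \<rho>'"
      using f by (cases f) (auto simp: kruskal_def \<rho>'_def links_def rothe_iff)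
    ultimately show ?thesis using uniq by blast
  qed
qed

section \<open>From the full CNM to the conditions\<close>

text \<open>All Rothe cells are now vertices, so no vertex has one both above it and to its left.
  Each violation of the conditions, combined with the crossing entries, would produce such a
  vertex.\<close>

lemma full_cnm_conditions:
  assumes T: "is_cnm n T" "leaf_matrix T = lv" and n: "2 \<le> n" and full: "T = lv \<union> rothe"
  shows "\<forall>k\<in>{1..n}. \<pi> k \<noteq> k" "\<forall>k\<in>{2..n-1}. (\<pi> k < k) \<noteq> (\<sigma> k < k)"
proof -
  have conn: "(1, n) \<in> (links rothe)\<^sup>*" using cnm_connected[OF T] n by simp
  note cross = connected_crossing[OF conn]
  have both: False if "(i, j) \<in> lv \<union> rothe" "(i', j) \<in> rothe" "(i, j') \<in> rothe" "i' < i" "j' < j"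
    for i j i' j'
  proof -
    have "(i, j) \<noteq> (1, 1)" using that by (auto simp: rothe_iff)
    then show False using cnm_has_up_or_left[OF T(1), of i j] that full by blast
  qed
  show nofix: "\<forall>k\<in>{1..n}. \<pi> k \<noteq> k"
  proof (rule ballI, rule notI)
    fix k assume k: "k \<in> {1..n}" "\<pi> k = k"
    have sk: "\<sigma> k = k" using k sigma_pi by metis
    have k1: "k \<noteq> 1" using cross(1)[of 1] n k by auto
    \<comment> \<open>Entries crossing the cut just before k yield a cell above and a cell to the
      left of the fixed point.\<close>
    obtain i j where ij: "i \<in> {1..k-1}" "k - 1 < \<pi> i" "j \<in> {1..k-1}" "k - 1 < \<sigma> j"
    proof -
      have "1 \<le> k - 1" "k - 1 < n" using k k1 by auto
      then show ?thesis using cross[of "k - 1"] that by blast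
    qed
    have "\<pi> i \<noteq> k" "\<sigma> j \<noteq> k" using ij k sk sigma_pi[of i] pi_sigma[of j] by auto
    then have "(i, k) \<in> rothe" "(k, j) \<in> rothe" using ij k sk by (auto simp: rothe_iff)
    moreover have "(k, k) \<in> lv" using k by (simp add: lv_iff)
    moreover have "i < k" "j < k" using ij by auto
    ultimately show False using both[of k k i j] by blast
  qed
  show "\<forall>k\<in>{2..n-1}. (\<pi> k < k) \<noteq> (\<sigma> k < k)"
  proof (rule ballI, rule notI)
    fix k assume k: "k \<in> {2..n-1}" and eq: "(\<pi> k < k) = (\<sigma> k < k)"
    have kn: "k \<in> {1..n}" using k by auto
    have ne: "\<pi> k \<noteq> k" "\<sigma> k \<noteq> k" using nofix kn pi_sigma[of k] by metis+
    have rng: "\<pi> k \<in> {1..n}" "\<sigma> k \<in> {1..n}" using kn pi_range sigma_range by blast+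
    have inv: "\<sigma> (\<pi> k) = k" "\<pi> (\<sigma> k) = k" using kn sigma_pi pi_sigma by blast+
    show False
    proof (cases "\<pi> k < k")
      case True
      \<comment> \<open>Here hook k carries two leaves, with the cell \<open>(?i, ?j)\<close> as
        common corner. A crossing row above \<open>?i\<close> or a crossing column left of
        \<open>?j\<close> would give one of these leaves a second predecessor. So both crossings lie
        beyond the corner, and then \<open>(i', j')\<close> has cells above and to the left.\<close>
      let ?i = "\<sigma> k" and ?j = "\<pi> k"
      have lt: "?i < k" "?j < k" using True eq by auto
      have leafs: "(k, ?j) \<in> lv" "(?i, k) \<in> lv" using kn rng inv by (auto simp: lv_iff)
      have c: "(?i, ?j) \<in> rothe" using lt rng inv by (auto simp: rothe_iff)
      obtain i' j' where ij: "i' \<in> {1..k}" "k < \<pi> i'" "j' \<in> {1..k}" "k < \<sigma> j'"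
      proof -
        have "1 \<le> k" "k < n" using k by auto
        then show ?thesis using cross[of k] that by blast
      qed
      have nk: "i' \<noteq> k" "j' \<noteq> k" using ij lt by auto
      have "\<not> i' < ?i"
      proof
        assume "i' < ?i"
        then have "(i', k) \<in> rothe" using ij kn by (auto simp: rothe_iff)
        then show False using both[of ?i k i' ?j] leafs c \<open>i' < ?i\<close> lt by blast
      qed
      then have "?i < i'" using ij inv by (metis linorder_neqE_nat nat_neq_iff)
      moreover have "\<not> j' < ?j"
      proof
        assume "j' < ?j"
        then have "(k, j') \<in> rothe" using ij kn by (auto simp: rothe_iff)
        then show False using both[of k ?j ?i j'] leafs c \<open>j' < ?j\<close> lt by blast
      qed
      then have "?j < j'" using ij inv by (metis linorder_neqE_nat nat_neq_iff)
      moreover have "(i', j') \<in> rothe" "(i', ?j) \<in> rothe" "(?i, j') \<in> rothe"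
        using ij nk k lt inv rng by (auto simp: rothe_iff)
      ultimately show False using both[of i' j' ?i ?j] by blast
    next
      case False
      \<comment> \<open>Hook k carries no leaf, so \<open>(k, k)\<close> is itself a cell; the
        crossings before k again supply cells above and to the left.\<close>
      then have gt: "k < \<pi> k" "k < \<sigma> k" using ne eq by auto
      obtain i j where ij: "i \<in> {1..k-1}" "k - 1 < \<pi> i" "j \<in> {1..k-1}" "k - 1 < \<sigma> j"
      proof -
      have "1 \<le> k - 1" "k - 1 < n" using k by auto
      then show ?thesis using cross[of "k - 1"] that by blast
    qed
      have "\<pi> i \<noteq> k" "\<sigma> j \<noteq> k" using ij k gt sigma_pi[of i] pi_sigma[of j] by auto
      then have "(i, k) \<in> rothe" "(k, j) \<in> rothe" "(k, k) \<in> rothe" using ij k gt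
        by (auto simp: rothe_iff)
      moreover have "i < k" "j < k" using ij by auto
      ultimately show False using both[of k k i j] by blast
    qed
  qed
qed

section \<open>From the conditions to a unique CNM\<close>

text \<open>Move the cut from k to \<open>Suc k\<close>. Either row \<open>Suc k\<close> contains
  the entry of the crossing column and column \<open>Suc k\<close> becomes the new crossing one, or
  the entry of column \<open>Suc k\<close> lies above the cut and the old crossing persists.\<close>

lemma unique_crossing:
  assumes nofix: "\<forall>k\<in>{1..n}. \<pi> k \<noteq> k" and alt: "\<forall>k\<in>{2..n-1}. (\<pi> k < k) \<noteq> (\<sigma> k < k)"
    and k: "1 \<le> k" "k < n"
  shows "\<exists>!j. j \<in> {1..k} \<and> k < \<sigma> j"
  using k
proof (induction k rule: dec_induct)
  case base
  have "\<sigma> 1 \<noteq> 1" using nofix pi_sigma[of 1] base by fastforce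
  then have "1 < \<sigma> 1" using sigma_range[of 1] base by auto
  then show ?case by (intro ex1I[of _ 1]) auto
next
  case (step k)
  then obtain j where j: "j \<in> {1..k}" "k < \<sigma> j"
    and uniq: "\<And>j'. j' \<in> {1..k} \<Longrightarrow> k < \<sigma> j' \<Longrightarrow> j' = j" by (metis Suc_lessD)
  let ?k = "Suc k"
  have kn: "?k \<in> {1..n}" "?k \<in> {2..n-1}" using step by auto
  have ne: "\<pi> ?k \<noteq> ?k" "\<sigma> ?k \<noteq> ?k" using nofix kn pi_sigma[of ?k] by metis+
  have inv: "\<sigma> (\<pi> ?k) = ?k" "\<pi> (\<sigma> ?k) = ?k" using kn sigma_pi pi_sigma by blast+
  show ?case
  proof (cases "\<sigma> ?k < ?k")
    case False
    then have "\<pi> ?k \<in> {1..k}" using alt kn pi_range[of ?k] by fastforce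
    then have "\<pi> ?k = j" using uniq inv by auto
    then have sj: "\<sigma> j = ?k" using inv by simp
    show ?thesis
    proof (rule ex1I[of _ ?k])
      show "?k \<in> {1..?k} \<and> ?k < \<sigma> ?k" using False ne by auto
      fix j' assume j': "j' \<in> {1..?k} \<and> ?k < \<sigma> j'"
      show "j' = ?k"
      proof (rule ccontr)
        assume "j' \<noteq> ?k"
        then have "j' = j" using uniq[of j'] j' by auto
        then show False using sj j' by simp
      qed
    qed
  next
    case True
    then have "\<not> \<pi> ?k < ?k" using alt kn by blast
    then have "\<sigma> j \<noteq> ?k" using j pi_sigma[of j] step by auto
    then have sj: "?k < \<sigma> j" using j by simp
    show ?thesis
    proof (rule ex1I[of _ j])
      show "j \<in> {1..?k} \<and> ?k < \<sigma> j" using j sj by simp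
      fix j' assume j': "j' \<in> {1..?k} \<and> ?k < \<sigma> j'"
      then have "j' \<noteq> ?k" using True by auto
      then show "j' = j" using uniq[of j'] j' by simp
    qed
  qed
qed

lemma crossing_eq:
  assumes nofix: "\<forall>k\<in>{1..n}. \<pi> k \<noteq> k" and alt: "\<forall>k\<in>{2..n-1}. (\<pi> k < k) \<noteq> (\<sigma> k < k)"
    and j: "j \<in> {1..n}" "j \<le> k" "k < \<sigma> j" and j': "j' \<in> {1..n}" "j' \<le> k" "k < \<sigma> j'"
  shows "j = j'"
proof -
  have k: "1 \<le> k" "k < n" using j sigma_range[of j] by auto
  have "j \<in> {1..k} \<and> k < \<sigma> j" "j' \<in> {1..k} \<and> k < \<sigma> j'" using j j' by auto
  then show ?thesis using unique_crossing[OF nofix alt k] by blast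
qed

text \<open>Otherwise columns j and j' would both cross the same horizontal cut, against
  \<open>unique_crossing\<close>.\<close>

lemma no_left_below_diagonal:
  assumes nofix: "\<forall>k\<in>{1..n}. \<pi> k \<noteq> k" and alt: "\<forall>k\<in>{2..n-1}. (\<pi> k < k) \<noteq> (\<sigma> k < k)"
    and p: "(i, j) \<in> lv \<union> rothe" "j \<le> i" and l: "(i, j') \<in> lv \<union> rothe" "j' < j"
  shows False
proof -
  note f = full_bounds[OF p(1)] full_bounds[OF l(1)]
  have l': "i < \<sigma> j'" using l p f by (auto simp: lv_iff rothe_iff)
  show False
  proof (cases "j = i")
    case True
    then have "\<pi> i \<noteq> j" using nofix f(1) by metis
    then have "(i, j) \<in> rothe" using p by (auto simp: lv_iff)
    then have "i < \<sigma> j" by (simp add: rothe_iff)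
    moreover have "j \<le> i" "j' \<le> i" using True l by auto
    ultimately have "j = j'" using crossing_eq[OF nofix alt f(2) _ _ f(6), of i] l' by blast
    then show False using l by simp
  next
    case False
    \<comment> \<open>The cut is taken before row i because \<open>(i, j)\<close> may be a leaf,
      with \<open>\<sigma> j = i\<close>. On the diagonal that is excluded by \<open>nofix\<close>,
      and the cut after row i works.\<close>
    then have "j \<le> i - 1" "i - 1 < \<sigma> j" "j' \<le> i - 1" "i - 1 < \<sigma> j'" using p l l' f by auto
    then have "j = j'" using crossing_eq[OF nofix alt f(2) _ _ f(6)] by blast
    then show False using l by simp
  qed
qed

text \<open>The column crossing the cut before j has its entry in row j or below, hence meets row i
  in a Rothe cell. Equality of the rows could occur only on the diagonal, where the entry of row j
  lies to the right.\<close>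

lemma has_left_above_diagonal:
  assumes nofix: "\<forall>k\<in>{1..n}. \<pi> k \<noteq> k" and alt: "\<forall>k\<in>{2..n-1}. (\<pi> k < k) \<noteq> (\<sigma> k < k)"
    and p: "(i, j) \<in> lv \<union> rothe" "i \<le> j" "(i, j) \<noteq> (1, 1)"
  shows "\<exists>j'<j. (i, j') \<in> rothe"
proof -
  note f = full_bounds[OF p(1)]
  have j: "2 \<le> j" using p f by auto
  then obtain j' where j': "j' \<in> {1..j-1}" "j - 1 < \<sigma> j'"
  proof -
    have "1 \<le> j - 1" "j - 1 < n" using j f by auto
    then show ?thesis using unique_crossing[OF nofix alt, of "j - 1"] that by blast
  qed
  have "i < \<sigma> j'"
  proof (cases "i = j")
    case True
    then have "\<pi> i \<noteq> j" using nofix f(1) by metis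
    then have "(j, j) \<in> rothe" using p True by (auto simp: lv_iff)
    then have "\<sigma> j' \<noteq> j" using pi_sigma[of j'] j' f by (auto simp: rothe_iff)
    then show ?thesis using j' True by auto
  qed (use j' p in auto)
  then show ?thesis using j' f by (intro exI[of _ j']) (auto simp: rothe_iff)
qed

text \<open>The first vertex of row i in \<open>T\<close> has no vertex to its left, so it has one
  above and by \<open>no_up\<close> lies below the diagonal. There the row holds only one candidate,
  namely \<open>(i, j)\<close>. The premise \<open>no_up\<close> is the transpose of
  \<open>no_left_below_diagonal\<close>; as a premise it lets the lemma be applied to the transpose
  too.\<close>

lemma rothe_below_diagonal_in_cnm:
  assumes nofix: "\<forall>k\<in>{1..n}. \<pi> k \<noteq> k" and alt: "\<forall>k\<in>{2..n-1}. (\<pi> k < k) \<noteq> (\<sigma> k < k)"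
    and T: "T \<subseteq> lv \<union> rothe" "lv \<subseteq> T" "(1, 1) \<in> T"
    and step: "\<And>i j. (i, j) \<in> T \<Longrightarrow> (i, j) \<noteq> (1, 1) \<Longrightarrow> (\<exists>i'<i. (i', j) \<in> T) \<or> (\<exists>j'<j. (i, j') \<in> T)"
    and no_up: "\<And>i j i'. (i, j) \<in> lv \<union> rothe \<Longrightarrow> i \<le> j \<Longrightarrow> (i', j) \<in> lv \<union> rothe \<Longrightarrow> i' < i \<Longrightarrow> False"
    and p: "(i, j) \<in> rothe" "j \<le> i"
  shows "(i, j) \<in> T"
proof (cases "(i, j) = (1, 1)")
  case False
  have b: "i \<in> {1..n}" "j \<in> {1..n}" "j < \<pi> i" "i < \<sigma> j" using p by (auto simp: rothe_iff)
  have i2: "i \<noteq> 1" using False p b by auto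
  note no_left = no_left_below_diagonal[OF nofix alt]
  have leaf: "(i, \<pi> i) \<in> T" using T(2) b pi_range by (auto simp: lv_iff)
  have up: "i < \<pi> i"
  proof (rule ccontr)
    assume "\<not> i < \<pi> i"
    then show False using no_left[of i "\<pi> i" j] leaf T p b by auto
  qed
  define m where "m = (LEAST m. (i, m) \<in> T)"
  have m: "(i, m) \<in> T" "\<And>m'. m' < m \<Longrightarrow> (i, m') \<notin> T"
    using leaf LeastI[of "\<lambda>m. (i, m) \<in> T"] not_less_Least[of _ "\<lambda>m. (i, m) \<in> T"]
    unfolding m_def by blast+
  have "\<exists>i'<i. (i', m) \<in> T" using step[OF m(1)] m(2) i2 by blast
  then have mi: "m < i" using no_up[of i m] m(1) T(1) by (meson not_less subsetD)
  have "m = j"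
    using no_left[of i j m] no_left[of i m j] p m(1) T(1) mi
    by (metis UnCI less_imp_le linorder_neqE_nat subsetD)
  then show ?thesis using m by simp
qed (use T in auto)

text \<open>The full set is a CNM: weakly above the diagonal vertices have predecessors only to the
  left, weakly below it only above, the root having none. Any other CNM with these leaves contains
  the cells weakly below the diagonal and, by transposition, those weakly above.\<close>

lemma full_unique_cnm:
  assumes nofix: "\<forall>k\<in>{1..n}. \<pi> k \<noteq> k" and alt: "\<forall>k\<in>{2..n-1}. (\<pi> k < k) \<noteq> (\<sigma> k < k)"
    and n: "2 \<le> n"
  shows "\<exists>!T. is_cnm n T \<and> leaf_matrix T = lv"
proof -
  interpret sw: leaves n \<sigma> \<pi> by (rule swap)
  have nofix': "\<forall>k\<in>{1..n}. \<sigma> k \<noteq> k" using nofix pi_sigma by metis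
  have alt': "\<forall>k\<in>{2..n-1}. (\<sigma> k < k) \<noteq> (\<pi> k < k)" using alt by auto
  note no_left = no_left_below_diagonal[OF nofix alt]
  have no_up: False if "(i, j) \<in> lv \<union> rothe" "i \<le> j" "(i', j) \<in> lv \<union> rothe" "i' < i" for i j i'
    using sw.no_left_below_diagonal[OF nofix' alt', of j i i'] that full_swap by blast
  note left = has_left_above_diagonal[OF nofix alt]
  have up: "\<exists>i'<i. (i', j) \<in> rothe" if "(i, j) \<in> lv \<union> rothe" "j \<le> i" "(i, j) \<noteq> (1, 1)" for i j
    using sw.has_left_above_diagonal[OF nofix' alt', of j i] that full_swap rothe_swap by blast
  have one: "1 \<in> {1..n}" using n by simp
  have "1 < \<pi> 1" "1 < \<sigma> 1" using pi_range[OF one] sigma_range[OF one] nofix nofix' one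
    by (metis atLeastAtMost_iff le_neq_implies_less)+
  then have root: "(1, 1) \<in> rothe" "(1, 1) \<notin> lv" using one by (auto simp: rothe_iff lv_iff)
  have ex1: "(\<exists>i'<i. (i', j) \<in> lv \<union> rothe) \<noteq> (\<exists>j'<j. (i, j') \<in> lv \<union> rothe)"
    if "(i, j) \<in> lv \<union> rothe" "(i, j) \<noteq> (1, 1)" for i j
  proof (cases "i \<le> j")
    case True
    then show ?thesis using left[OF that(1) True that(2)] no_up[OF that(1) True] by blast
  next
    case False
    then have le: "j \<le> i" by simp
    then show ?thesis using up[OF that(1) le that(2)] no_left[OF that(1) le] by blast
  qed
  have rT: "(1, 1) \<in> lv \<union> rothe" using root by simp
  have C: "is_cnm n (lv \<union> rothe) \<and> leaf_matrix (lv \<union> rothe) = lv"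
    using cnm_criterion[OF order_refl refl rT ex1 root(2)] by blast
  show ?thesis
  proof (rule ex1I)
    show "is_cnm n (lv \<union> rothe) \<and> leaf_matrix (lv \<union> rothe) = lv" by (rule C)
    fix T assume T: "is_cnm n T \<and> leaf_matrix T = lv"
    then have sub: "lv \<subseteq> T" "T \<subseteq> lv \<union> rothe" using cnm_subset_full by blast+
    have r: "(1, 1) \<in> T" using T by (simp add: is_cnm_def)
    have step: "(\<exists>i'<i. (i', j) \<in> T) \<or> (\<exists>j'<j. (i, j') \<in> T)"
      if "(i, j) \<in> T" "(i, j) \<noteq> (1, 1)" for i j
      using cnm_has_up_or_left[of n T i j] T that by blast
    have low: "(i, j) \<in> T" if "(i, j) \<in> rothe" "j \<le> i" for i j
      using step no_up
      by (intro rothe_below_diagonal_in_cnm[OF nofix alt sub(2,1) r _ _ that]) blast+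
    \<comment> \<open>The converse relation is the transposed matrix; the roles of
      \<open>no_up\<close> and \<open>no_left\<close> are exchanged.\<close>
    have "(j, i) \<in> T\<inverse>" if ij: "(i, j) \<in> rothe" "i \<le> j" for i j
    proof (rule sw.rothe_below_diagonal_in_cnm[OF nofix' alt', where T = "T\<inverse>"])
      show "T\<inverse> \<subseteq> sw.lv \<union> sw.rothe" using sub(2) full_swap by auto
      show "sw.lv \<subseteq> T\<inverse>" using sub(1) lv_swap by auto
      show "(1, 1) \<in> T\<inverse>" using r by simp
      show "(\<exists>i'<i. (i', j) \<in> T\<inverse>) \<or> (\<exists>j'<j. (i, j') \<in> T\<inverse>)"
        if "(i, j) \<in> T\<inverse>" "(i, j) \<noteq> (1, 1)" for i j
        using step[of j i] that by auto
      show False if "(i, j) \<in> sw.lv \<union> sw.rothe" "i \<le> j" "(i', j) \<in> sw.lv \<union> sw.rothe" "i' < i"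
        for i j i'
        using no_left[of j i i'] that full_swap by blast
      show "(j, i) \<in> sw.rothe" "i \<le> j" using ij rothe_swap by auto
    qed
    then have "(i, j) \<in> T" if "(i, j) \<in> rothe" for i j
      using low[OF that] that by (cases "i \<le> j") auto
    then have "rothe \<subseteq> T" by auto
    then show "T = lv \<union> rothe" using sub by blast
  qed
qed

section \<open>Translation to permutation matrices\<close>

text \<open>Hook k can contain only the entries of row k and of column k, each exactly when it comes
  before the diagonal; they are distinct because k is not fixed.\<close>

lemma card_L_subset:
  assumes k: "k \<in> {1..n}" and ne: "\<pi> k \<noteq> k"
  shows "card (lv \<inter> L_subset k) = 1 \<longleftrightarrow> (\<pi> k < k) \<noteq> (\<sigma> k < k)"
proof -
  have ne': "\<sigma> k \<noteq> k" using ne pi_sigma[OF k] by auto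
  have "lv \<inter> L_subset k =
      (if \<pi> k < k then {(k, \<pi> k)} else {}) \<union> (if \<sigma> k < k then {(\<sigma> k, k)} else {})"
  proof -
    have row: "(k, b) \<in> lv \<longleftrightarrow> b = \<pi> k" for b using k pi_range[OF k] by (auto simp: lv_iff)
    have col: "(a, k) \<in> lv \<longleftrightarrow> a = \<sigma> k" for a using k sigma_range[OF k] by (auto simp: lv_iff')
    have "(a, b) \<in> lv \<inter> L_subset k \<longleftrightarrow>
        (a = k \<and> b = \<pi> k \<and> \<pi> k < k) \<or> (a = \<sigma> k \<and> b = k \<and> \<sigma> k < k)" for a b
      using row col ne ne' unfolding L_subset_def
      by (cases "a = k"; cases "b = k") (auto simp: le_less)
    then show ?thesis by (auto split: if_splits)
  qed
  then show ?thesis using ne ne' by auto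
qed

end

theorem theorem3p4:
  fixes n :: nat and P :: "(nat \<times> nat) set"
  assumes "n \<ge> 2" and "perm_matrix n P"
  shows "(\<exists>!T. is_cnm n T \<and> leaf_matrix T = P) \<longleftrightarrow>
         ((\<forall>k. 2 \<le> k \<and> k \<le> n - 1 \<longrightarrow> card (P \<inter> L_subset k) = 1) \<and>
          (\<forall>i. (i, i) \<notin> P))"
proof -
  \<comment> \<open>Outside \<open>{1..n}\<close> these values are arbitrary; \<open>leaves\<close>
    constrains them only inside.\<close>
  define \<pi> where "\<pi> i = (THE j. (i, j) \<in> P)" for i
  define \<sigma> where "\<sigma> j = (THE i. (i, j) \<in> P)" for j
  have grid: "i \<in> {1..n}" "j \<in> {1..n}" if "(i, j) \<in> P" for i j
    using assms(2) that by (auto simp: perm_matrix_def grid_def)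
  have pi: "(i, j) \<in> P \<longleftrightarrow> j = \<pi> i" if "i \<in> {1..n}" for i j
  proof -
    have "\<exists>!j. (i, j) \<in> P" using assms(2) that unfolding perm_matrix_def by blast
    then show ?thesis unfolding \<pi>_def by (metis the_equality)
  qed
  have sigma: "(i, j) \<in> P \<longleftrightarrow> i = \<sigma> j" if "j \<in> {1..n}" for i j
  proof -
    have "\<exists>!i. (i, j) \<in> P" using assms(2) that unfolding perm_matrix_def by blast
    then show ?thesis unfolding \<sigma>_def by (metis the_equality)
  qed
  interpret leaves n \<pi> \<sigma>
  proof
    fix i assume i: "i \<in> {1..n}"
    have a: "(i, \<pi> i) \<in> P" and b: "(\<sigma> i, i) \<in> P" using pi sigma i by blast+
    show "\<pi> i \<in> {1..n}" "\<sigma> i \<in> {1..n}" using grid a b by blast+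
    then show "\<sigma> (\<pi> i) = i" "\<pi> (\<sigma> i) = i" using a b pi sigma by metis+
  qed
  have P: "P = lv"
  proof (rule set_eqI)
    fix p show "p \<in> P \<longleftrightarrow> p \<in> lv"
      using grid pi pi_range by (cases p) (metis lv_iff)
  qed
  have diag: "(\<forall>i. (i, i) \<notin> P) \<longleftrightarrow> (\<forall>k\<in>{1..n}. \<pi> k \<noteq> k)"
    unfolding P by (metis lv_iff)
  \<comment> \<open>The absence of fixed points is assumed here because a fixed point k would be the
    single entry of its hook while both inequalities fail.\<close>
  have L: "(\<forall>k. 2 \<le> k \<and> k \<le> n - 1 \<longrightarrow> card (P \<inter> L_subset k) = 1) \<longleftrightarrow>
      (\<forall>k\<in>{2..n-1}. (\<pi> k < k) \<noteq> (\<sigma> k < k))" if "\<forall>k\<in>{1..n}. \<pi> k \<noteq> k"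
  proof -
    have "card (P \<inter> L_subset k) = 1 \<longleftrightarrow> (\<pi> k < k) \<noteq> (\<sigma> k < k)" if "2 \<le> k" "k \<le> n - 1" for k
      unfolding P using card_L_subset[of k] \<open>\<forall>k\<in>{1..n}. \<pi> k \<noteq> k\<close> that by simp
    then show ?thesis by (meson atLeastAtMost_iff)
  qed
  show ?thesis
  proof
    assume "\<exists>!T. is_cnm n T \<and> leaf_matrix T = P"
    then obtain T where T0: "is_cnm n T \<and> leaf_matrix T = lv"
      and uniq: "\<forall>T'. is_cnm n T' \<and> leaf_matrix T' = lv \<longrightarrow> T' = T"
      unfolding P by (rule ex1E)
    from T0 have T: "is_cnm n T" "leaf_matrix T = lv" by (rule conjunct1, rule conjunct2)
    have "rothe \<subseteq> T"
      using unique_cnm_contains_rothe[OF T assms(1) uniq[rule_format, OF conjI]] .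
    then have "T = lv \<union> rothe" using cnm_subset_full[OF T] by (simp only: subset_antisym Un_least)
    note c = full_cnm_conditions[OF T assms(1) this]
    show "(\<forall>k. 2 \<le> k \<and> k \<le> n - 1 \<longrightarrow> card (P \<inter> L_subset k) = 1) \<and> (\<forall>i. (i, i) \<notin> P)"
      using L[OF c(1)] diag c by (simp only: simp_thms)
  next
    assume a: "(\<forall>k. 2 \<le> k \<and> k \<le> n - 1 \<longrightarrow> card (P \<inter> L_subset k) = 1) \<and> (\<forall>i. (i, i) \<notin> P)"
    have nofix: "\<forall>k\<in>{1..n}. \<pi> k \<noteq> k" using conjunct2[OF a] unfolding diag .
    have "\<forall>k\<in>{2..n-1}. (\<pi> k < k) \<noteq> (\<sigma> k < k)"
      using conjunct1[OF a] unfolding L[OF nofix] .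
    from full_unique_cnm[OF nofix this assms(1)]
    show "\<exists>!T. is_cnm n T \<and> leaf_matrix T = P" unfolding P .
  qed
qed

end
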